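(* Let $\alpha,\beta,\gamma$ be positive irrational numbers with $\alpha+\beta+\gamma=1$, $\beta<1/2$ and $\alpha<\gamma$. Then there exists a partition of $\mathbb{N}$ into three sets $A,B,C$ such that for every $n\in\mathbb{N}$, $$A(n)\in\{\lfloor n\alpha\rfloor,\lceil n\alpha\rceil\},\quad B(n)\in\{\lfloor n\beta\rfloor,\lceil n\beta\rceil\},\quad C(n)\in\{\lfloor n\gamma\rfloor,\lceil n\gamma\rceil\},$$ where for $S\subseteq\mathbb{N}$, $S(n)=\#\{m\le n: m\in S\}$ denotes the counting function.
   Context: $\mathbb{N}=\{1,2,3,\dots\}$. *)

theory Defs
  imports Complex_Main
begin

(* Intended for S \<subseteq> {1..}; an element 0 of S would be counted as well. *)
definition counting :: "nat set \<Rightarrow> nat \<Rightarrow> nat" where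
  "counting S n = card {m. m \<le> n \<and> m \<in> S}"

end

theory Submission
  imports Defs
begin

text \<open>Earliest-deadline-first scheduling. Read the time steps as slots of a single machine, each of
  which executes one unit of some task \<open>i\<close> of rate \<open>w i\<close>. The \<open>(c + 1)\<close>-st unit of \<open>i\<close> may be executed
  in slot \<open>n\<close> if \<open>c < n * w i\<close> and has deadline \<open>(c + 1) / w i\<close>; always execute an available unit with
  the smallest deadline. Availability yields the upper bounds on the counts. If a deadline \<open>\<le> t\<close> were
  missed at \<open>t\<close>, go back to the last slot \<open>s\<close> that executed a unit with deadline \<open>> t\<close>: all units
  executed after \<open>s\<close>, and the late one, become available after \<open>s\<close> and are due by \<open>t\<close>, but there are
  at most \<open>(t - s) * w i\<close> such units of each task \<open>i\<close>, so at most \<open>t - s\<close> altogether.\<close>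

text \<open>If no task were available in slot \<open>Suc n\<close>, the counts would sum to at least
  \<open>n + 1\<close>; so finitely many, but some, candidates compete for the smallest
  deadline.\<close>

lemma edf_step:
  fixes w :: "'i \<Rightarrow> real" and c :: "'i \<Rightarrow> nat"
  assumes "finite I" "sum w I = 1" "sum c I = n"
  shows "\<exists>k\<in>I. real (c k) < real (Suc n) * w k \<and>
    (\<forall>j\<in>I. real (c j) < real (Suc n) * w j \<longrightarrow> (real (c k) + 1) / w k \<le> (real (c j) + 1) / w j)"
proof -
  define E where "E = {i\<in>I. real (c i) < real (Suc n) * w i}"
  have "E \<noteq> {}"
  proof
    assume "E = {}"
    then have "(\<Sum>i\<in>I. real (Suc n) * w i) \<le> (\<Sum>i\<in>I. real (c i))"
      by (intro sum_mono) (auto simp: E_def not_less)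
    also have "\<dots> = real n"
      using assms(3) by (metis of_nat_sum)
    finally show False
      using assms(2) by (simp add: sum_distrib_left[symmetric])
  qed
  moreover have "finite E"
    using assms(1) by (simp add: E_def)
  ultimately obtain k where "is_arg_min (\<lambda>i. (real (c i) + 1) / w i) (\<lambda>i. i \<in> E) k"
    using ex_is_arg_min_if_finite by blast
  then show ?thesis
    by (auto simp: is_arg_min_linorder E_def)
qed

text \<open>\<open>c n\<close> records the units executed in slots \<open>1\<close> to
  \<open>n\<close>, and \<open>k n\<close> is the task run in slot \<open>Suc n\<close>; hence the
  \<open>Suc n\<close> in the availability conditions.\<close>

locale edf_schedule =
  fixes I :: "'i set" and w :: "'i \<Rightarrow> real" and k :: "nat \<Rightarrow> 'i" and c :: "nat \<Rightarrow> 'i \<Rightarrow> nat"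
  assumes w_pos: "i \<in> I \<Longrightarrow> w i > 0"
    and w_sum: "sum w I = 1"
    and k_in: "k n \<in> I"
    and c_0: "c 0 i = 0"
    and c_Suc: "c (Suc n) = (c n)(k n := Suc (c n (k n)))"
    and c_sum: "sum (c n) I = n"
    and available: "real (c n (k n)) < real (Suc n) * w (k n)"
    and earliest: "j \<in> I \<Longrightarrow> real (c n j) < real (Suc n) * w j
      \<Longrightarrow> (real (c n (k n)) + 1) / w (k n) \<le> (real (c n j) + 1) / w j"
begin

lemma finite_I: "finite I"
  by (rule ccontr) (use w_sum in simp)

lemma count_mono: "m \<le> n \<Longrightarrow> c m i \<le> c n i"
  by (rule lift_Suc_mono_le[of "\<lambda>n. c n i"]) (simp_all add: c_Suc)

lemma count_upper:
  assumes "i \<in> I"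
  shows "real (c n i) < real n * w i + 1"
proof (induction n)
  case 0
  then show ?case by (simp add: c_0)
next
  case (Suc n)
  then show ?case
    using available[of n] w_pos[OF assms] by (auto simp: c_Suc algebra_simps)
qed

text \<open>Deadlines are cleared of denominators:
  \<open>real (c u j) + 1 \<le> real t * w j\<close> says that the next unit of \<open>j\<close> is
  due by \<open>t\<close>. The last conclusion says that such a unit is not yet available in slot
  \<open>s\<close>.\<close>

lemma busy_period:
  obtains s where "s \<le> t"
    "\<And>u. s \<le> u \<Longrightarrow> u < t \<Longrightarrow> real (c u (k u)) + 1 \<le> real t * w (k u)"
    "\<And>j. j \<in> I \<Longrightarrow> real (c s j) + 1 \<le> real t * w j \<Longrightarrow> real s * w j \<le> real (c s j)"
proof -
  define early where "early u \<longleftrightarrow> real (c u (k u)) + 1 \<le> real t * w (k u)" for u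
  \<comment> \<open>The value \<open>t\<close> qualifies vacuously. By minimality, if
    \<open>s > 0\<close>, slot \<open>s\<close> itself executes a unit due after
    \<open>t\<close>.\<close>
  define s where "s = (LEAST s. \<forall>u. s \<le> u \<and> u < t \<longrightarrow> early u)"
  have s: "\<forall>u. s \<le> u \<and> u < t \<longrightarrow> early u"
    unfolding s_def by (rule LeastI[of _ t]) auto
  have "s \<le> t"
    unfolding s_def by (rule Least_le) auto
  moreover have "real s * w j \<le> real (c s j)"
    if j: "j \<in> I" and due: "real (c s j) + 1 \<le> real t * w j" for j
  proof (cases s)
    case 0
    then show ?thesis by simp
  next
    case (Suc u)
    have "\<not> (\<forall>v. u \<le> v \<and> v < t \<longrightarrow> early v)"
      using not_less_Least[of u "\<lambda>s. \<forall>u. s \<le> u \<and> u < t \<longrightarrow> early u"] Suc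
      unfolding s_def by auto
    then have late: "real (c u (k u)) + 1 > real t * w (k u)"
      using s Suc by (metis early_def not_less Suc_leI le_neq_implies_less)
    \<comment> \<open>The next unit of \<open>k u\<close> is due even later than the one just
      executed.\<close>
    then have "j \<noteq> k u"
      using due by (auto simp: Suc c_Suc)
    then have eq: "c s j = c u j"
      by (simp add: Suc c_Suc)
    show ?thesis
    proof (rule ccontr)
      assume "\<not> ?thesis"
      then have "real (c u j) < real (Suc u) * w j"
        unfolding eq by (simp add: Suc)
      then have "(real (c u (k u)) + 1) / w (k u) \<le> (real (c u j) + 1) / w j"
        by (rule earliest[OF j])
      also have "\<dots> \<le> real t"
        using due w_pos[OF j] by (simp add: eq pos_divide_le_eq)
      finally show False
        using late w_pos[OF k_in[of u]] by (simp add: pos_divide_le_eq)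
    qed
  qed
  ultimately show ?thesis
    using that[of s] s by (auto simp: early_def)
qed

lemma count_lower:
  assumes "i \<in> I"
  shows "real (c t i) > real t * w i - 1"
proof (rule ccontr)
  assume "\<not> ?thesis"
  then have missed: "real (c t i) + 1 \<le> real t * w i"
    by simp
  obtain s where st: "s \<le> t"
    and early: "\<And>u. s \<le> u \<Longrightarrow> u < t \<Longrightarrow> real (c u (k u)) + 1 \<le> real t * w (k u)"
    and start: "\<And>j. j \<in> I \<Longrightarrow> real (c s j) + 1 \<le> real t * w j \<Longrightarrow> real s * w j \<le> real (c s j)"
    using busy_period by blast
  \<comment> \<open>This is the deadline of the last executed unit of \<open>j\<close>, so no
    \<open>+ 1\<close> occurs.\<close>
  have run: "c s j < c v j \<Longrightarrow> real (c v j) \<le> real t * w j" if "s \<le> v" "v \<le> t" for v j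
    using that
  proof (induction v rule: dec_induct)
    case base
    then show ?case by simp
  next
    case (step v)
    then show ?case
      using early[of v] by (cases "j = k v") (auto simp: c_Suc algebra_simps)
  qed
  \<comment> \<open>A task run after \<open>s\<close> has count at least \<open>s * w j\<close> at
    \<open>s\<close> and at most \<open>t * w j\<close> at \<open>t\<close>; any other task gains
    nothing.\<close>
  have gain: "real (c t j) - real (c s j) \<le> (real t - real s) * w j" if "j \<in> I" for j
  proof (cases "c s j < c t j")
    case True
    then have "real (c t j) \<le> real t * w j"
      using run[OF st order.refl] by blast
    moreover from this have "real s * w j \<le> real (c s j)"
      using True by (intro start that) linarith
    ultimately show ?thesis
      by (simp add: algebra_simps)
  next
    case False
    then show ?thesis
      using count_mono[OF st, of j] st w_pos[OF that] by simp
  qed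
  have "real s * w i \<le> real (c s i)"
    using missed count_mono[OF st, of i] by (intro start assms) linarith
  then have "real (c t i) - real (c s i) < (real t - real s) * w i"
    using missed by (simp add: algebra_simps)
  \<comment> \<open>The late unit makes the bound for \<open>i\<close> strict, yet both sums equal
    \<open>t - s\<close>.\<close>
  then have "(\<Sum>j\<in>I. real (c t j) - real (c s j)) < (\<Sum>j\<in>I. (real t - real s) * w j)"
    using finite_I gain assms by (intro sum_strict_mono_ex1) auto
  moreover have "(\<Sum>j\<in>I. real (c u j)) = real u" for u
    using c_sum[of u] by (metis of_nat_sum)
  ultimately show False
    by (simp add: sum_subtractf sum_distrib_left[symmetric] w_sum)
qed

end

lemma edf_schedule_exists:
  fixes w :: "'i \<Rightarrow> real"
  assumes "\<And>i. i \<in> I \<Longrightarrow> w i > 0" and w_sum: "sum w I = 1"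
  obtains k c where "edf_schedule I w k c"
proof -
  have fin: "finite I"
    by (rule ccontr) (use w_sum in simp)
  define Q where "Q n c c' k \<longleftrightarrow> k \<in> I \<and> c' = c(k := Suc (c k)) \<and> real (c k) < real (Suc n) * w k \<and>
      (\<forall>j\<in>I. real (c j) < real (Suc n) * w j \<longrightarrow> (real (c k) + 1) / w k \<le> (real (c j) + 1) / w j)"
    for n and c c' :: "'i \<Rightarrow> nat" and k
  \<comment> \<open>Dependent choice carries the invariant \<open>sum (c n) I = n\<close>, which
    \<open>edf_step\<close> needs; the clause for \<open>n = 0\<close> pins the initial
    state.\<close>
  have "\<exists>c. \<forall>n. (sum (c n) I = n \<and> (n = 0 \<longrightarrow> c n = (\<lambda>_. 0))) \<and> (\<exists>k. Q n (c n) (c (Suc n)) k)"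
  proof (rule dependent_nat_choice)
    show "\<exists>c :: 'i \<Rightarrow> nat. sum c I = 0 \<and> ((0::nat) = 0 \<longrightarrow> c = (\<lambda>_. 0))"
      by (rule exI[of _ "\<lambda>_. 0"]) simp
  next
    fix c :: "'i \<Rightarrow> nat" and n
    assume c: "sum c I = n \<and> (n = 0 \<longrightarrow> c = (\<lambda>_. 0))"
    obtain k where k: "k \<in> I" "real (c k) < real (Suc n) * w k"
      "\<forall>j\<in>I. real (c j) < real (Suc n) * w j \<longrightarrow> (real (c k) + 1) / w k \<le> (real (c j) + 1) / w j"
      using edf_step[OF fin w_sum conjunct1[OF c]] by auto
    have "sum (c(k := Suc (c k))) I = Suc n"
    proof -
      have "sum (c(k := Suc (c k))) (I - {k}) = sum c (I - {k})"
        by (intro sum.cong) auto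
      then show ?thesis
        using c sum.remove[OF fin k(1), of c] sum.remove[OF fin k(1), of "c(k := Suc (c k))"] by simp
    qed
    moreover have "Q n c (c(k := Suc (c k))) k"
      using k unfolding Q_def by blast
    ultimately show "\<exists>c'. (sum c' I = Suc n \<and> (Suc n = 0 \<longrightarrow> c' = (\<lambda>_. 0))) \<and> (\<exists>k. Q n c c' k)"
      by (intro exI[of _ "c(k := Suc (c k))"] conjI impI exI[of _ k]) simp_all
  qed
  then obtain c where c: "\<forall>n. (sum (c n) I = n \<and> (n = 0 \<longrightarrow> c n = (\<lambda>_. 0))) \<and> (\<exists>k. Q n (c n) (c (Suc n)) k)"
    by (rule exE)
  from c have "\<forall>n. \<exists>k. Q n (c n) (c (Suc n)) k"
    by iprover
  then obtain k where Q: "\<forall>n. Q n (c n) (c (Suc n)) (k n)"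
    by (rule choice[THEN exE])
  have "edf_schedule I w k c"
  proof
    fix n
    have step: "Q n (c n) (c (Suc n)) (k n)"
      using Q by (rule spec)
    show "k n \<in> I" "c (Suc n) = (c n)(k n := Suc (c n (k n)))"
      "real (c n (k n)) < real (Suc n) * w (k n)"
      using step unfolding Q_def by iprover+
    show "(real (c n (k n)) + 1) / w (k n) \<le> (real (c n j) + 1) / w j"
      if "j \<in> I" "real (c n j) < real (Suc n) * w j" for j
      using step that unfolding Q_def by blast
    show "c 0 i = 0" for i
      using spec[OF c, of 0] by simp
    show "sum (c n) I = n"
      using c by iprover
  qed (fact assms)+
  then show ?thesis
    by (rule that)
qed

lemma counting_0: "0 \<notin> S \<Longrightarrow> counting S 0 = 0"
  by (auto simp: counting_def)

lemma counting_Suc: "counting S (Suc n) = counting S n + (if Suc n \<in> S then 1 else 0)"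
proof -
  have "{m. m \<le> Suc n \<and> m \<in> S} = (if Suc n \<in> S then {Suc n} else {}) \<union> {m. m \<le> n \<and> m \<in> S}"
    by (auto simp: le_Suc_eq)
  then show ?thesis
    by (auto simp: counting_def)
qed

theorem quota_partition:
  fixes w :: "'i \<Rightarrow> real"
  assumes "\<And>i. i \<in> I \<Longrightarrow> w i > 0" and "sum w I = 1"
  shows "\<exists>S :: 'i \<Rightarrow> nat set. (\<Union>i\<in>I. S i) = {1..} \<and> (\<forall>i j. i \<noteq> j \<longrightarrow> S i \<inter> S j = {}) \<and>
    (\<forall>i\<in>I. \<forall>n. int (counting (S i) n) \<in> {\<lfloor>real n * w i\<rfloor>, \<lceil>real n * w i\<rceil>})"
proof -
  obtain k c where "edf_schedule I w k c"
    by (rule edf_schedule_exists[OF assms])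
  then interpret edf_schedule I w k c .
  \<comment> \<open>Slot \<open>m\<close> is run by \<open>k (m - 1)\<close>; the guard excludes
    \<open>0\<close>, where subtraction truncates.\<close>
  define S where "S i = {m. 1 \<le> m \<and> k (m - 1) = i}" for i
  have count: "counting (S i) n = c n i" for i n
    by (induction n) (auto simp: counting_0 counting_Suc S_def c_0 c_Suc)
  show ?thesis
  proof (intro exI[of _ S] conjI allI impI ballI)
    show "(\<Union>i\<in>I. S i) = {1..}"
      using k_in by (auto simp: S_def)
    show "S i \<inter> S j = {}" if "i \<noteq> j" for i j
      using that by (auto simp: S_def)
    show "int (counting (S i) n) \<in> {\<lfloor>real n * w i\<rfloor>, \<lceil>real n * w i\<rceil>}" if "i \<in> I" for i n
      \<comment> \<open>An integer at distance less than 1 from a real is its floor or its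
        ceiling.\<close>
      using count_lower[OF that, of n] count_upper[OF that, of n]
      unfolding count insert_iff by linarith
  qed
qed

theorem theorem5:
  fixes \<alpha> \<beta> \<gamma> :: real
  assumes "\<alpha> > 0" and "\<beta> > 0" and "\<gamma> > 0"
    and "\<alpha> \<notin> \<rat>" and "\<beta> \<notin> \<rat>" and "\<gamma> \<notin> \<rat>"
    and "\<alpha> + \<beta> + \<gamma> = 1"
    and "\<beta> < 1 / 2"
    and "\<alpha> < \<gamma>"
  shows "\<exists>A B C :: nat set.
    A \<union> B \<union> C = {1..} \<and> A \<inter> B = {} \<and> A \<inter> C = {} \<and> B \<inter> C = {} \<and>
    (\<forall>n\<in>{1..}.
      int (counting A n) \<in> {\<lfloor>real n * \<alpha>\<rfloor>, \<lceil>real n * \<alpha>\<rceil>} \<and>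
      int (counting B n) \<in> {\<lfloor>real n * \<beta>\<rfloor>, \<lceil>real n * \<beta>\<rceil>} \<and>
      int (counting C n) \<in> {\<lfloor>real n * \<gamma>\<rfloor>, \<lceil>real n * \<gamma>\<rceil>})"
proof -
  define w where "w i = [\<alpha>, \<beta>, \<gamma>] ! i" for i
  have w: "w 0 = \<alpha>" "w 1 = \<beta>" "w 2 = \<gamma>"
    by (simp_all add: w_def)
  have "w i > 0" if "i \<in> {0, 1, 2}" for i
    using that assms(1-3) w by auto
  moreover have "sum w {0, 1, 2} = 1"
    using assms(7) w by simp
  ultimately obtain S :: "nat \<Rightarrow> nat set"
    where S: "(\<Union>i\<in>{0, 1, 2}. S i) = {1..}" "\<forall>i j. i \<noteq> j \<longrightarrow> S i \<inter> S j = {}"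
      and count: "\<forall>i\<in>{0, 1, 2}. \<forall>n. int (counting (S i) n) \<in> {\<lfloor>real n * w i\<rfloor>, \<lceil>real n * w i\<rceil>}"
    using quota_partition[of "{0, 1, 2}" w] by auto
  then have "S 0 \<union> S 1 \<union> S 2 = {1..}" "S 0 \<inter> S 1 = {}" "S 0 \<inter> S 2 = {}" "S 1 \<inter> S 2 = {}"
    using S by (simp_all add: Un_assoc)
  moreover have "int (counting (S 0) n) \<in> {\<lfloor>real n * \<alpha>\<rfloor>, \<lceil>real n * \<alpha>\<rceil>}"
    "int (counting (S 1) n) \<in> {\<lfloor>real n * \<beta>\<rfloor>, \<lceil>real n * \<beta>\<rceil>}"
    "int (counting (S 2) n) \<in> {\<lfloor>real n * \<gamma>\<rfloor>, \<lceil>real n * \<gamma>\<rceil>}" for n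
    using count by (simp_all flip: w)
  ultimately show ?thesis
    by (intro exI[of _ "S 0"] exI[of _ "S 1"] exI[of _ "S 2"] conjI ballI)
qed

end
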